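(* Let $I\subseteq\mathbb{R}$ be an open interval that is unbounded to the right. Suppose that a function $f\colon I\to\mathbb{R}$ is infinitely differentiable and that its $q$th derivative $f^{(q)}$ is completely monotone on $I$ for some $q\in\mathbb{N}$. Then, for any $a\in I$, the function $f$ admits the Newton series expansion $$ f(x) = \sum_{k=0}^{\infty}\binom{x-a}{k}\,\Delta^k f(a)\qquad (x\in I), $$ and the convergence of the series is uniform on compact subsets of $I$.
   Context: $\mathbb{N}$ denotes the set of nonnegative integers. A function $h\colon I\to\mathbb{R}$ on an open interval $I$ is completely monotone if it is infinitely differentiable and $(-1)^n h^{(n)}(x)\geq 0$ for all $x\in I$ and all $n\in\mathbb{N}$ (with $h^{(0)}=h$). $\Delta$ denotes the forward difference operator, $\Delta f(x)=f(x+1)-f(x)$, and $\Delta^k$ its $k$th iterate ($\Delta^0 f=f$). For $z\in\mathbb{R}$ and $k\in\mathbb{N}$, $\binom{z}{k}=\frac{z(z-1)\cdots(z-k+1)}{k!}$ (equal to $1$ when $k=0$). *)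

theory Defs
  imports "HOL-Analysis.Analysis"
begin

text \<open>
  A function on an open set \<open>I\<close> is represented by a total function on the reals whose values
  outside \<open>I\<close> are irrelevant. Since \<open>I\<close> is open and derivatives are local, the iterated
  derivative \<open>(deriv ^^ n) f\<close> at a point of \<open>I\<close> depends only on the restriction of \<open>f\<close> to \<open>I\<close>.
  As \<open>deriv\<close> is total, existence of all the derivatives has to be required explicitly.
\<close>

definition infinitely_differentiable_on :: "(real \<Rightarrow> real) \<Rightarrow> real set \<Rightarrow> bool" where
  "infinitely_differentiable_on f I \<longleftrightarrow>
     (\<forall>n::nat. \<forall>x\<in>I. (deriv ^^ n) f field_differentiable (at x))"

definition completely_monotone_on :: "(real \<Rightarrow> real) \<Rightarrow> real set \<Rightarrow> bool" where
  "completely_monotone_on h I \<longleftrightarrow>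
     infinitely_differentiable_on h I \<and>
     (\<forall>n::nat. \<forall>x\<in>I. (-1) ^ n * (deriv ^^ n) h x \<ge> 0)"

definition forward_diff :: "(real \<Rightarrow> real) \<Rightarrow> real \<Rightarrow> real" where
  "forward_diff f = (\<lambda>x. f (x + 1) - f x)"

end

theory Submission
  imports Defs "HOL-Computational_Algebra.Polynomial"
begin

text \<open>
  Let \<open>P\<^sub>n\<close> be the \<open>n\<close>th partial sum. It interpolates \<open>f\<close> at the nodes \<open>a, \<dots>, a + n - 1\<close>, so
  \<open>f - P\<^sub>n = D\<^sub>n w\<^sub>n\<close> with \<open>w\<^sub>n\<close> the nodal polynomial and \<open>D\<^sub>n\<close> a divided difference of order \<open>n\<close>.
  By the mean value theorem for divided differences, for \<open>n \<ge> q\<close> the function \<open>(-1)\<^sup>n\<^sup>-\<^sup>q D\<^sub>n\<close> is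
  nonnegative and decreasing off the nodes. If \<open>y \<in> I\<close> lies to the left of \<open>a\<close>, then from the
  \<open>q\<close>th one on, the terms of the series at \<open>y\<close> and the remainders at \<open>y\<close> all have the sign
  \<open>(-1)\<^sup>q\<close>; hence the remainders at \<open>y\<close> are bounded. For \<open>x > y\<close> monotonicity of \<open>D\<^sub>n\<close> bounds the
  remainder at \<open>x\<close> by the one at \<open>y\<close> times \<open>\<bar>w\<^sub>n(x) / w\<^sub>n(y)\<bar>\<close>, and this ratio tends to zero because
  the harmonic series diverges.
\<close>

section \<open>Interpolation and the mean value theorem for divided differences\<close>

text \<open>Rolle's theorem between neighbouring zeros gives one zero of \<open>g 1\<close> in each
  gap, hence one fewer in all. The functions form a chain of successive derivatives so that the
  induction hypothesis applies to the chain shifted by one.\<close>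

lemma generalized_Rolle:
  fixes g :: "nat \<Rightarrow> real \<Rightarrow> real"
  assumes I: "is_interval I"
    and g: "\<And>n x. x \<in> I \<Longrightarrow> (g n has_real_derivative g (Suc n) x) (at x)"
    and S: "finite S" "S \<subseteq> I" "card S = Suc m" "\<And>x. x \<in> S \<Longrightarrow> g 0 x = 0"
  shows "\<exists>\<xi>\<in>I. g m \<xi> = 0"
  using g S
proof (induction m arbitrary: g S)
  case 0
  then have "S \<noteq> {}" by auto
  then show ?case using 0(3,5) by blast
next
  case (Suc m)
  define l where "l = sorted_list_of_set S"
  have len: "length l = Suc (Suc m)" and set_l: "set l = S"
    using Suc.prems by (auto simp: l_def)
  have mono: "l ! i < l ! j" if "i < j" "j < Suc (Suc m)" for i j
    using that len strict_sorted_list_of_set[of S]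
    by (auto simp: l_def sorted_wrt_iff_nth_less)
  have mem: "l ! i \<in> S" if "i < Suc (Suc m)" for i
    using that len set_l nth_mem by metis
  have "\<exists>z. l ! i < z \<and> z < l ! Suc i \<and> z \<in> I \<and> g 1 z = 0" if i: "i < Suc m" for i
  proof -
    have lt: "l ! i < l ! Suc i" using mono i by simp
    have sub: "t \<in> I" if "l ! i \<le> t" "t \<le> l ! Suc i" for t
      by (rule mem_is_interval_1_I[OF I _ _ that]) (use mem i Suc.prems(3) in auto)
    have "\<exists>z. l ! i < z \<and> z < l ! Suc i \<and> DERIV (g 0) z :> 0"
    proof (rule Rolle[OF lt])
      show "g 0 (l ! i) = g 0 (l ! Suc i)" using Suc.prems(5) mem i by simp
      show "continuous_on {l ! i..l ! Suc i} (g 0)"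
        by (rule DERIV_continuous_on[where D = "g 1"])
          (use Suc.prems(1)[of _ 0] sub in \<open>auto intro: has_field_derivative_at_within\<close>)
      show "g 0 differentiable (at t)" if "l ! i < t" "t < l ! Suc i" for t
        using Suc.prems(1)[of t 0] sub[of t] that by (auto simp: real_differentiable_def)
    qed
    then obtain z where z: "l ! i < z" "z < l ! Suc i" "DERIV (g 0) z :> 0" by blast
    moreover have "z \<in> I" using sub z by simp
    ultimately show ?thesis using Suc.prems(1)[of z 0] DERIV_unique by fastforce
  qed
  then obtain z where z: "\<And>i. i < Suc m \<Longrightarrow> l ! i < z i \<and> z i < l ! Suc i \<and> z i \<in> I \<and> g 1 (z i) = 0"
    by metis
  have zless: "z i < z j" if "i < j" "j < Suc m" for i j
  proof -
    have "l ! Suc i \<le> l ! j" using mono[of "Suc i" j] that by (cases "Suc i = j") auto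
    then show ?thesis using z[of i] z[of j] that by auto
  qed
  have inj: "inj_on z {..<Suc m}"
    by (rule linorder_inj_onI) (use zless in \<open>auto simp: less_le\<close>)
  have "\<exists>\<xi>\<in>I. g (Suc m) \<xi> = 0"
    using Suc.IH[of "\<lambda>n. g (Suc n)" "z ` {..<Suc m}"] Suc.prems(1) z card_image[OF inj] by auto
  then show ?case .
qed

lemma infinitely_differentiable_onD:
  assumes "infinitely_differentiable_on f I" "x \<in> I"
  shows "((deriv ^^ n) f has_real_derivative (deriv ^^ Suc n) f x) (at x)"
  using assms by (auto simp: infinitely_differentiable_on_def DERIV_deriv_iff_field_differentiable)

text \<open>Generalized Rolle applied to \<open>f - p\<close>, whose \<open>m\<close>th derivative
  is that of \<open>f\<close> minus the constant \<open>fact m * coeff p m\<close>. This coefficient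
  is the divided difference of \<open>f\<close> over \<open>S\<close>.\<close>

lemma interpolation_mvt:
  fixes p :: "real poly"
  assumes I: "is_interval I" and f: "infinitely_differentiable_on f I"
    and S: "finite S" "S \<subseteq> I" "card S = Suc m" "\<And>x. x \<in> S \<Longrightarrow> poly p x = f x"
    and p: "degree p \<le> m"
  shows "\<exists>\<xi>\<in>I. (deriv ^^ m) f \<xi> = fact m * coeff p m"
proof -
  define g where "g = (\<lambda>n x. (deriv ^^ n) f x - poly ((pderiv ^^ n) p) x)"
  have "\<exists>\<xi>\<in>I. g m \<xi> = 0"
  proof (rule generalized_Rolle[OF I _ S(1-3)])
    show "(g n has_real_derivative g (Suc n) x) (at x)" if "x \<in> I" for n x
      unfolding g_def
      using DERIV_diff[OF infinitely_differentiable_onD[OF f that, of n] poly_DERIV] by simp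
    show "g 0 x = 0" if "x \<in> S" for x using S(4)[OF that] by (simp add: g_def)
  qed
  then obtain \<xi> where \<xi>: "\<xi> \<in> I" "(deriv ^^ m) f \<xi> = poly ((pderiv ^^ m) p) \<xi>"
    by (auto simp: g_def)
  have "degree ((pderiv ^^ m) p) = 0" using p by (simp add: degree_higher_pderiv)
  then obtain c where c: "(pderiv ^^ m) p = [:c:]" by (rule degree_eq_zeroE)
  have "coeff ((pderiv ^^ m) p) 0 = fact m * coeff p m"
    by (simp add: coeff_higher_pderiv pochhammer_fact)
  then show ?thesis using \<xi> c by auto
qed

section \<open>Newton interpolation polynomials at equidistant nodes\<close>

definition nodal_poly :: "real \<Rightarrow> nat \<Rightarrow> real poly" where
  "nodal_poly a n = (\<Prod>i<n. [:- (a + real i), 1:])"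

definition newton_poly :: "(real \<Rightarrow> real) \<Rightarrow> real \<Rightarrow> nat \<Rightarrow> real poly" where
  "newton_poly f a n = (\<Sum>k<n. smult ((forward_diff ^^ k) f a / fact k) (nodal_poly a k))"

lemma poly_nodal_poly: "poly (nodal_poly a n) x = (\<Prod>i<n. x - a - real i)"
  by (simp add: nodal_poly_def poly_prod algebra_simps)

lemma poly_nodal_poly_eq_0_iff: "poly (nodal_poly a n) x = 0 \<longleftrightarrow> x \<in> (\<lambda>i. a + real i) ` {..<n}"
  by (auto simp: poly_nodal_poly algebra_simps)

lemma degree_nodal_poly [simp]: "degree (nodal_poly a n) = n"
  by (simp add: nodal_poly_def degree_prod_eq_sum_degree)

lemma coeff_nodal_poly_self [simp]: "coeff (nodal_poly a n) n = 1"
proof -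
  have "lead_coeff (nodal_poly a n) = 1"
    by (simp add: nodal_poly_def lead_coeff_prod)
  then show ?thesis by simp
qed

lemma poly_newton_poly:
  "poly (newton_poly f a n) x = (\<Sum>k<n. ((x - a) gchoose k) * (forward_diff ^^ k) f a)"
  by (simp add: newton_poly_def poly_sum poly_nodal_poly gbinomial_prod_rev atLeast0LessThan mult.commute)

lemma newton_poly_Suc:
  "newton_poly f a (Suc n) =
     newton_poly f a n + smult ((forward_diff ^^ n) f a / fact n) (nodal_poly a n)"
  by (simp add: newton_poly_def)

lemma coeff_newton_poly_eq_0:
  assumes "n \<le> m"
  shows "coeff (newton_poly f a n) m = 0"
  using assms by (auto simp: newton_poly_def coeff_sum coeff_eq_0)

lemma degree_newton_poly: "degree (newton_poly f a n) \<le> n"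
  by (rule degree_le) (simp add: coeff_newton_poly_eq_0)

text \<open>Since \<open>f\<close> is arbitrary in the induction, the hypothesis serves both
  \<open>f\<close> and \<open>forward_diff f\<close>; Pascal's rule merges the two sums.\<close>

lemma newton_forward_formula:
  "f (a + real j) = (\<Sum>k\<le>j. real (j choose k) * (forward_diff ^^ k) f a)"
proof (induction j arbitrary: f)
  case 0
  then show ?case by simp
next
  case (Suc j)
  let ?d = "\<lambda>k. (forward_diff ^^ k) f a"
  have "f (a + real (Suc j)) = f (a + real j) + forward_diff f (a + real j)"
    by (simp add: forward_diff_def algebra_simps)
  also have "forward_diff f (a + real j) = (\<Sum>k\<le>j. real (j choose k) * ?d (Suc k))"
    by (subst Suc.IH) (simp add: funpow_swap1)
  also have "f (a + real j) = (\<Sum>k\<le>j. real (j choose k) * ?d k)"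
    by (rule Suc.IH)
  \<comment> \<open>The added term vanishes because \<open>j choose Suc j\<close> is zero.\<close>
  also have "(\<Sum>k\<le>j. real (j choose k) * ?d k) = (\<Sum>k\<le>Suc j. real (j choose k) * ?d k)"
    by simp
  also have "\<dots> = ?d 0 + (\<Sum>k\<le>j. real (j choose Suc k) * ?d (Suc k))"
    by (subst sum.atMost_Suc_shift) simp
  also have "\<dots> + (\<Sum>k\<le>j. real (j choose k) * ?d (Suc k)) =
      ?d 0 + (\<Sum>k\<le>j. real (Suc j choose Suc k) * ?d (Suc k))"
    by (simp add: sum.distrib algebra_simps)
  also have "\<dots> = (\<Sum>k\<le>Suc j. real (Suc j choose k) * ?d k)"
    by (subst sum.atMost_Suc_shift) simp
  finally show ?case .
qed

lemma newton_poly_interpolates: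
  assumes "j < n"
  shows "poly (newton_poly f a n) (a + real j) = f (a + real j)"
proof -
  have "poly (newton_poly f a n) (a + real j) =
      (\<Sum>k<n. real (j choose k) * (forward_diff ^^ k) f a)"
    by (simp add: poly_newton_poly binomial_gbinomial)
  also have "\<dots> = (\<Sum>k\<le>j. real (j choose k) * (forward_diff ^^ k) f a)"
    using assms by (intro sum.mono_neutral_right) auto
  finally show ?thesis using newton_forward_formula by metis
qed

section \<open>Vanishing of infinite products\<close>

text \<open>From \<open>1 - t \<le> exp (- t)\<close>, the product is at most a constant times
  \<open>exp (- d * harm n)\<close>, and the harmonic numbers diverge.\<close>

lemma prod_tendsto_zero:
  fixes c :: "nat \<Rightarrow> real"
  assumes nonneg: "\<And>i. 0 \<le> c i" and d: "d > 0"
    and le: "\<And>i. i \<ge> N \<Longrightarrow> c i \<le> 1 - d / real (Suc i)"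
  shows "(\<lambda>n. \<Prod>i<n. c i) \<longlonglongrightarrow> 0"
proof -
  \<comment> \<open>Chosen so that the bound below is an equality at \<open>n = N\<close>.\<close>
  define C where "C = (\<Prod>i<N. c i) * exp (d * harm N)"
  have bound: "(\<Prod>i<n. c i) \<le> C * exp (- d * harm n)" if "n \<ge> N" for n
    using that
  proof (induction n rule: dec_induct)
    case base
    then show ?case by (simp add: C_def mult.assoc flip: exp_add)
  next
    case (step n)
    have "c n \<le> exp (- d / real (Suc n))"
      using le[OF step(1)] exp_ge_add_one_self[of "- d / real (Suc n)"] by simp
    then have "(\<Prod>i<Suc n. c i) \<le> C * exp (- d * harm n) * exp (- d / real (Suc n))"
      unfolding prod.lessThan_Suc
      by (intro mult_mono step(3) nonneg order_trans[OF prod_nonneg step(3)]) (use nonneg in auto)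
    also have "\<dots> = C * exp (- d * harm (Suc n))"
      by (simp add: harm_Suc mult.assoc divide_inverse algebra_simps flip: exp_add)
    finally show ?case .
  qed
  have "filterlim (\<lambda>n. d * (harm n :: real)) at_top sequentially"
    by (rule filterlim_tendsto_pos_mult_at_top[OF tendsto_const d harm_at_top])
  then have "(\<lambda>n. exp (- d * harm n)) \<longlonglongrightarrow> 0"
    by (auto intro!: filterlim_compose[OF exp_at_bot] simp: filterlim_uminus_at_bot)
  then have "(\<lambda>n. C * exp (- d * harm n)) \<longlonglongrightarrow> 0"
    by (rule tendsto_mult_right_zero)
  then show ?thesis
    by (rule tendsto_sandwich[rotated -1, where f = "\<lambda>_. 0"])
      (use bound in \<open>auto intro!: always_eventually eventually_sequentiallyI[of N] prod_nonneg nonneg\<close>)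
qed

text \<open>The ratio is bounded factor by factor, uniformly in \<open>x\<close>. All but finitely
  many factor bounds are \<open>1 - (s - y) / (a + real i - y)\<close>, so their product tends to
  zero.\<close>

lemma nodal_poly_ratio_vanishes:
  fixes a s t y :: real
  assumes "y < s" "y < a"
  shows "\<exists>b. b \<longlonglongrightarrow> 0 \<and>
    (\<forall>n. \<forall>x\<in>{s..t}. \<bar>poly (nodal_poly a n) x\<bar> \<le> b n * \<bar>poly (nodal_poly a n) y\<bar>)"
proof -
  \<comment> \<open>\<open>u i\<close> bounds the distance from \<open>x\<close> to the node
    \<open>a + real i\<close> on \<open>{s..t}\<close>: it is sharp for nodes to the right of the
    interval and crude for the others.\<close>
  define u where "u = (\<lambda>i. if a + real i \<ge> t then a + real i - s
    else \<bar>s - a - real i\<bar> + \<bar>t - a - real i\<bar>)"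
  \<comment> \<open>The \<open>max\<close> keeps \<open>c i\<close> nonnegative even if
    \<open>{s..t}\<close> is empty.\<close>
  define c where "c = (\<lambda>i. max 0 (u i) / (a + real i - y))"
  \<comment> \<open>Being at least \<open>1\<close> and at least \<open>a - y\<close>,
    \<open>B\<close> satisfies \<open>a + real i - y \<le> B * real (Suc i)\<close>.\<close>
  define B where "B = max 1 (a - y)"
  have B: "B > 0" "a - y \<le> B" "1 \<le> B" by (auto simp: B_def)
  have pos: "a + real i - y > 0" for i using assms by simp
  obtain N where N: "real N \<ge> \<bar>s - a\<bar> + \<bar>t - a\<bar>" using real_arch_simple by blast
  have "(\<lambda>n. \<Prod>i<n. c i) \<longlonglongrightarrow> 0"
  proof (rule prod_tendsto_zero)
    show "0 \<le> c i" for i using pos[of i] by (simp add: c_def)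
    show "(s - y) / B > 0" using assms B by simp
    show "c i \<le> 1 - (s - y) / B / real (Suc i)" if "N \<le> i" for i
    proof -
      have "real N \<le> real i" using that by simp
      then have "a + real i \<ge> t" "a + real i \<ge> s" using N by linarith+
      then have ci: "c i = 1 - (s - y) / (a + real i - y)"
        using pos[of i] by (simp add: c_def u_def field_simps)
      have "1 * real i \<le> B * real i" using B by (intro mult_right_mono) auto
      then have "a + real i - y \<le> B * real (Suc i)" using B by (simp add: algebra_simps)
      then have "(s - y) / (B * real (Suc i)) \<le> (s - y) / (a + real i - y)"
        using pos[of i] assms by (intro divide_left_mono) auto
      then show ?thesis using ci by simp
    qed
  qed
  moreover have "\<bar>poly (nodal_poly a n) x\<bar> \<le> (\<Prod>i<n. c i) * \<bar>poly (nodal_poly a n) y\<bar>"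
    if x: "x \<in> {s..t}" for n x
  proof -
    have "\<bar>poly (nodal_poly a n) x\<bar> = (\<Prod>i<n. \<bar>x - a - real i\<bar>)"
      by (simp add: poly_nodal_poly abs_prod)
    also have "\<dots> \<le> (\<Prod>i<n. c i * \<bar>y - a - real i\<bar>)"
    proof (intro prod_mono conjI)
      fix i
      have "\<bar>x - a - real i\<bar> \<le> max 0 (u i)" using x by (auto simp: u_def)
      also have "\<dots> = c i * (a + real i - y)" using pos[of i] by (simp add: c_def)
      also have "a + real i - y = \<bar>y - a - real i\<bar>" using pos[of i] by simp
      finally show "\<bar>x - a - real i\<bar> \<le> c i * \<bar>y - a - real i\<bar>" .
    qed simp
    also have "\<dots> = (\<Prod>i<n. c i) * \<bar>poly (nodal_poly a n) y\<bar>"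
      by (simp add: poly_nodal_poly abs_prod prod.distrib)
    finally show ?thesis .
  qed
  ultimately show ?thesis by blast
qed

section \<open>The remainder\<close>

locale newton_expansion =
  fixes I :: "real set" and f :: "real \<Rightarrow> real" and q :: nat and a :: real
  assumes interval: "is_interval I" and unbounded: "\<not> bdd_above I"
    and smooth: "infinitely_differentiable_on f I"
    and cm: "completely_monotone_on ((deriv ^^ q) f) I"
    and a_in: "a \<in> I"
begin

lemma node_in: "a + real i \<in> I"
proof -
  obtain u where "u \<in> I" "a + real i \<le> u"
    using unbounded by (meson bdd_above.I linear)
  then show ?thesis using mem_is_interval_1_I[OF interval a_in] by simp
qed

section \<open>Signs of interpolation coefficients and divided differences\<close>

lemma deriv_sign:
  assumes "x \<in> I"
  shows "0 \<le> (-1) ^ n * (deriv ^^ (q + n)) f x"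
  using cm assms by (simp add: completely_monotone_on_def add.commute[of q] funpow_add)

text \<open>Up to a positive factorial, the coefficient is a value of the derivative of order
  \<open>q + n\<close>, whose sign complete monotonicity prescribes.\<close>

lemma interpolation_sign:
  assumes "finite S" "S \<subseteq> I" "card S = Suc (q + n)" "\<And>x. x \<in> S \<Longrightarrow> poly p x = f x"
    and "degree p \<le> q + n"
  shows "0 \<le> (-1) ^ n * coeff p (q + n)"
proof -
  obtain \<xi> where "\<xi> \<in> I" "(deriv ^^ (q + n)) f \<xi> = fact (q + n) * coeff p (q + n)"
    using interpolation_mvt[OF interval smooth assms] by blast
  then have "0 \<le> fact (q + n) * ((-1) ^ n * coeff p (q + n))"
    using deriv_sign[of \<xi> n] by (simp add: mult.left_commute)
  moreover have "(0::real) < fact (q + n)" by simp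
  ultimately show ?thesis by (meson linorder_not_le mult_pos_neg)
qed

abbreviation nodes :: "nat \<Rightarrow> real set" where
  "nodes n \<equiv> (\<lambda>i. a + real i) ` {..<n}"

lemma nodes: "finite (nodes n)" "nodes n \<subseteq> I" "card (nodes n) = n"
  using node_in by (auto simp: card_image inj_on_def)

definition remainder :: "nat \<Rightarrow> real \<Rightarrow> real" where
  "remainder n x = f x - poly (newton_poly f a n) x"

lemma remainder_node: "x \<in> nodes n \<Longrightarrow> remainder n x = 0"
  by (auto simp: remainder_def newton_poly_interpolates)

text \<open>Up to a factorial, this difference is the top coefficient of the interpolant at
  \<open>q + n + 1\<close> equidistant nodes.\<close>

lemma forward_diff_sign: "0 \<le> (-1) ^ n * (forward_diff ^^ (q + n)) f a"
proof -
  have "0 \<le> (-1) ^ n * coeff (newton_poly f a (Suc (q + n))) (q + n)"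
  proof (rule interpolation_sign[OF nodes])
    show "degree (newton_poly f a (Suc (q + n))) \<le> q + n"
      by (rule degree_le) (simp add: coeff_newton_poly_eq_0)
  qed (auto intro: newton_poly_interpolates)
  then have "0 \<le> (-1) ^ n * (forward_diff ^^ (q + n)) f a / fact (q + n)"
    by (simp add: newton_poly_Suc coeff_newton_poly_eq_0)
  moreover have "(0::real) < fact (q + n)" by simp
  ultimately show ?thesis by (meson linorder_not_le divide_neg_pos)
qed

text \<open>Off the nodes this is the divided difference of \<open>f\<close> at the \<open>n\<close>
  nodes and \<open>x\<close>. At a node the quotient takes the default value
  \<open>0\<close>.\<close>

definition divided_diff :: "nat \<Rightarrow> real \<Rightarrow> real" where
  "divided_diff n x = remainder n x / poly (nodal_poly a n) x"

lemma remainder_eq: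
  assumes "x \<notin> nodes n"
  shows "remainder n x = divided_diff n x * poly (nodal_poly a n) x"
  using assms poly_nodal_poly_eq_0_iff[of a n x] by (simp add: divided_diff_def)

lemma divided_diff_sign:
  assumes x: "x \<in> I" "x \<notin> nodes (q + n)"
  shows "0 \<le> (-1) ^ n * divided_diff (q + n) x"
proof -
  let ?m = "q + n"
  \<comment> \<open>The interpolant at the nodes and \<open>x\<close>; its top coefficient is the
    divided difference.\<close>
  define p where "p = newton_poly f a ?m + smult (divided_diff ?m x) (nodal_poly a ?m)"
  have "0 \<le> (-1) ^ n * coeff p ?m"
  proof (rule interpolation_sign)
    show "finite (insert x (nodes ?m))" "insert x (nodes ?m) \<subseteq> I"
      "card (insert x (nodes ?m)) = Suc ?m"
      using x nodes[of ?m] by auto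
    show "degree p \<le> ?m"
      unfolding p_def by (intro degree_add_le degree_newton_poly) (simp add: degree_smult_eq)
    show "poly p t = f t" if "t \<in> insert x (nodes ?m)" for t
    proof (cases "t = x")
      case True
      then show ?thesis using remainder_eq[OF x(2)] by (simp add: p_def remainder_def)
    next
      case False
      then show ?thesis
        using that remainder_node[of t ?m] poly_nodal_poly_eq_0_iff[of a ?m t]
        by (auto simp: p_def remainder_def)
    qed
  qed
  then show ?thesis by (simp add: p_def coeff_newton_poly_eq_0)
qed

text \<open>The difference quotient of \<open>divided_diff\<close> between \<open>y\<close> and
  \<open>x\<close> is a divided difference of order one higher, so its sign is that of
  \<open>(-1) ^ Suc n\<close>.\<close>

lemma divided_diff_antimono:
  assumes y: "y \<in> I" "y \<notin> nodes (q + n)" and x: "x \<in> I" "x \<notin> nodes (q + n)" and "y < x"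
  shows "(-1) ^ n * divided_diff (q + n) x \<le> (-1) ^ n * divided_diff (q + n) y"
proof -
  let ?m = "q + n"
  define c where "c = (divided_diff ?m x - divided_diff ?m y) / (x - y)"
  \<comment> \<open>The interpolant at the nodes, \<open>y\<close> and \<open>x\<close>: the linear
    factor takes the values of \<open>divided_diff\<close> at \<open>y\<close> and
    \<open>x\<close>.\<close>
  define p where "p = newton_poly f a ?m + nodal_poly a ?m * [:divided_diff ?m y - c * y, c:]"
  have p_eq: "poly p t = poly (newton_poly f a ?m) t +
      poly (nodal_poly a ?m) t * (divided_diff ?m y + c * (t - y))" for t
    by (simp add: p_def algebra_simps)
  have deg: "degree (nodal_poly a ?m * [:divided_diff ?m y - c * y, c:]) \<le> Suc ?m"
    by (rule order_trans[OF degree_mult_le]) simp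
  have "0 \<le> (-1) ^ Suc n * coeff p (q + Suc n)"
  proof (rule interpolation_sign)
    show "finite (insert y (insert x (nodes ?m)))" "insert y (insert x (nodes ?m)) \<subseteq> I"
      "card (insert y (insert x (nodes ?m))) = Suc (q + Suc n)"
      using x y \<open>y < x\<close> nodes[of ?m] by auto
    show "degree p \<le> q + Suc n"
      unfolding p_def using deg degree_newton_poly[of f a ?m] by (intro degree_add_le) auto
    show "poly p t = f t" if "t \<in> insert y (insert x (nodes ?m))" for t
    proof -
      consider "t = y" | "t = x" | "t \<in> nodes ?m" using \<open>t \<in> _\<close> by auto
      then show ?thesis
      proof cases
        case 1
        then show ?thesis using remainder_eq[OF y(2)] by (simp add: p_eq remainder_def algebra_simps)
      next
        case 2
        have "c * (x - y) = divided_diff ?m x - divided_diff ?m y" using \<open>y < x\<close> by (simp add: c_def)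
        then show ?thesis using 2 remainder_eq[OF x(2)] by (simp add: p_eq remainder_def mult.commute)
      next
        case 3
        then show ?thesis
          using remainder_node[of t ?m] poly_nodal_poly_eq_0_iff[of a ?m t]
          by (simp add: p_eq remainder_def)
      qed
    qed
  qed
  \<comment> \<open>For \<open>c = 0\<close> the linear factor is constant, so the sum of the
    degrees falls below \<open>Suc ?m\<close>.\<close>
  moreover have "coeff p (Suc ?m) = c"
    using coeff_mult_degree_sum[of "nodal_poly a ?m" "[:divided_diff ?m y - c * y, c:]"]
    by (cases "c = 0") (auto simp: p_def coeff_newton_poly_eq_0 coeff_eq_0)
  ultimately have "(-1) ^ n * c \<le> 0" by simp
  then have "(-1) ^ n * c * (x - y) \<le> 0" using \<open>y < x\<close> by (simp add: mult_le_0_iff)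
  then have "(-1) ^ n * (c * (x - y)) \<le> 0" by (simp only: mult.assoc)
  moreover have "c * (x - y) = divided_diff ?m x - divided_diff ?m y" using \<open>y < x\<close> by (simp add: c_def)
  ultimately have "(-1) ^ n * (divided_diff ?m x - divided_diff ?m y) \<le> 0" by (simp only:)
  then show ?thesis by (simp only: right_diff_distrib diff_le_0_iff_le)
qed

section \<open>Bounds for the remainder and uniform convergence\<close>

lemma nodal_poly_sign:
  assumes "y < a"
  shows "0 \<le> (-1) ^ n * poly (nodal_poly a n) y"
proof -
  have "(-1) ^ n * poly (nodal_poly a n) y = (\<Prod>i<n. - 1 * (y - a - real i))"
    unfolding poly_nodal_poly prod.distrib by simp
  also have "\<dots> \<ge> 0" using assms by (intro prod_nonneg) auto
  finally show ?thesis .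
qed

lemma left_not_node: "y < a \<Longrightarrow> y \<notin> nodes n"
  by auto

text \<open>Multiplied by \<open>(-1) ^ q\<close>, the remainders of order at least \<open>q\<close>
  are nonnegative, and so is each term subtracted to pass to the next one. They therefore
  decrease.\<close>

lemma remainder_left_bounded:
  assumes y: "y \<in> I" "y < a"
  shows "\<bar>remainder (q + n) y\<bar> \<le> \<bar>remainder q y\<bar>"
proof -
  have sign_mult: "0 \<le> (-1) ^ q * (u * v)"
    if "0 \<le> (-1) ^ m * u" "0 \<le> (-1) ^ (q + m) * v" for u v :: real and m
  proof -
    have "0 \<le> ((-1) ^ m * u) * ((-1) ^ (q + m) * v)" using that by (rule mult_nonneg_nonneg)
    also have "\<dots> = (-1) ^ q * (u * v) * ((-1) ^ m * (-1) ^ m)"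
      by (simp add: power_add ac_simps)
    finally show ?thesis by (simp flip: power_mult_distrib)
  qed
  have nonneg: "0 \<le> (-1) ^ q * remainder (q + m) y" for m
    using sign_mult[OF divided_diff_sign nodal_poly_sign] y left_not_node
    by (simp add: remainder_eq)
  have step: "(-1) ^ q * remainder (q + Suc m) y \<le> (-1) ^ q * remainder (q + m) y" for m
  proof -
    have "0 \<le> (-1) ^ m * ((forward_diff ^^ (q + m)) f a / fact (q + m))"
      using forward_diff_sign[of m] by (simp add: zero_le_divide_iff)
    from sign_mult[OF this nodal_poly_sign[OF y(2)]] show ?thesis
      by (simp add: remainder_def newton_poly_Suc algebra_simps)
  qed
  have "(-1) ^ q * remainder (q + n) y \<le> (-1) ^ q * remainder q y"
    by (induction n) (use step order_trans in auto)
  moreover have "\<bar>remainder m y\<bar> = \<bar>(-1) ^ q * remainder m y\<bar>" for m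
    by (simp add: abs_mult)
  ultimately show ?thesis using nonneg[of n] nonneg[of 0] by simp
qed

text \<open>Sign and monotonicity of the divided difference make its absolute value at
  \<open>x\<close> at most that at \<open>y\<close>. Multiplying by both nodal values avoids
  quotients.\<close>

lemma remainder_comparison:
  assumes y: "y \<in> I" "y < a" and x: "x \<in> I" "y < x"
  shows "\<bar>remainder (q + n) x\<bar> * \<bar>poly (nodal_poly a (q + n)) y\<bar> \<le>
    \<bar>remainder q y\<bar> * \<bar>poly (nodal_poly a (q + n)) x\<bar>"
proof (cases "x \<in> nodes (q + n)")
  case True
  then show ?thesis by (simp add: remainder_node)
next
  case False
  let ?m = "q + n"
  note ny = left_not_node[OF y(2), of ?m]
  have "\<bar>(-1) ^ n * divided_diff ?m x\<bar> \<le> \<bar>(-1) ^ n * divided_diff ?m y\<bar>"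
    using divided_diff_sign[OF x(1) False] divided_diff_antimono[OF y(1) ny x(1) False x(2)] by simp
  then have "\<bar>divided_diff ?m x\<bar> \<le> \<bar>divided_diff ?m y\<bar>" by (simp add: abs_mult)
  then have "\<bar>remainder ?m x\<bar> * \<bar>poly (nodal_poly a ?m) y\<bar> \<le>
      \<bar>remainder ?m y\<bar> * \<bar>poly (nodal_poly a ?m) x\<bar>"
    by (auto simp: remainder_eq[OF False] remainder_eq[OF ny] abs_mult mult.commute
        mult.left_commute intro!: mult_left_mono)
  also have "\<dots> \<le> \<bar>remainder q y\<bar> * \<bar>poly (nodal_poly a ?m) x\<bar>"
    by (intro mult_right_mono remainder_left_bounded y) auto
  finally show ?thesis .
qed

lemma uniform_limit_newton_poly:
  assumes "open I" and K: "compact K" "K \<subseteq> I"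
  shows "uniform_limit K (\<lambda>n. poly (newton_poly f a n)) f sequentially"
proof -
  \<comment> \<open>Including \<open>a\<close> makes the set nonempty and places its minimum
    \<open>s\<close> at or below \<open>a\<close>.\<close>
  have "compact (insert a K)" using K by simp
  then obtain s t where s: "s \<in> insert a K" "\<And>x. x \<in> insert a K \<Longrightarrow> s \<le> x"
    and t: "\<And>x. x \<in> insert a K \<Longrightarrow> x \<le> t"
    using compact_attains_inf compact_attains_sup by (metis insert_not_empty)
  obtain e where e: "e > 0" "ball s e \<subseteq> I"
    using \<open>open I\<close> s K a_in by (metis insert_subset openE subsetD)
  \<comment> \<open>As \<open>I\<close> is open, there is room in it for a comparison point strictly
    to the left of both \<open>K\<close> and \<open>a\<close>.\<close>
  define y where "y = s - e / 2"
  have y: "y \<in> I" "y < s" "y < a"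
    using e s(2)[of a] by (auto simp: y_def dist_real_def intro!: subsetD[OF e(2)])
  obtain b where b: "b \<longlonglongrightarrow> 0" and b_bound:
    "\<And>n x. x \<in> {s..t} \<Longrightarrow> \<bar>poly (nodal_poly a n) x\<bar> \<le> b n * \<bar>poly (nodal_poly a n) y\<bar>"
    using nodal_poly_ratio_vanishes[OF y(2,3)] by blast
  have bound: "\<bar>remainder n x\<bar> \<le> \<bar>remainder q y\<bar> * b n" if "x \<in> K" "q \<le> n" for n x
  proof -
    have x: "x \<in> I" "y < x" "x \<in> {s..t}" using that K s t y by force+
    have "\<bar>remainder n x\<bar> * \<bar>poly (nodal_poly a n) y\<bar> \<le>
        \<bar>remainder q y\<bar> * \<bar>poly (nodal_poly a n) x\<bar>"
      using remainder_comparison[OF y(1,3) x(1,2), of "n - q"] that by simp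
    also have "\<dots> \<le> \<bar>remainder q y\<bar> * (b n * \<bar>poly (nodal_poly a n) y\<bar>)"
      by (intro mult_left_mono b_bound x) simp
    finally have "\<bar>remainder n x\<bar> * \<bar>poly (nodal_poly a n) y\<bar> \<le>
        (\<bar>remainder q y\<bar> * b n) * \<bar>poly (nodal_poly a n) y\<bar>" by (simp add: mult.assoc)
    moreover have "\<bar>poly (nodal_poly a n) y\<bar> > 0"
      using left_not_node[OF y(3)] poly_nodal_poly_eq_0_iff by simp
    ultimately show ?thesis by (rule mult_right_le_imp_le)
  qed
  have lim: "(\<lambda>n. \<bar>remainder q y\<bar> * b n) \<longlonglongrightarrow> 0" by (rule tendsto_mult_right_zero[OF b])
  show ?thesis
  proof (rule uniform_limitI)
    fix \<epsilon> :: real assume "\<epsilon> > 0"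
    with lim have "\<forall>\<^sub>F n in sequentially. \<bar>remainder q y\<bar> * b n < \<epsilon>"
      by (rule order_tendstoD)
    with eventually_ge_at_top[of q]
    show "\<forall>\<^sub>F n in sequentially. \<forall>x\<in>K. dist (poly (newton_poly f a n) x) (f x) < \<epsilon>"
    proof eventually_elim
      case (elim n)
      then show ?case using bound[of _ n]
        by (auto simp: dist_real_def remainder_def abs_minus_commute intro: le_less_trans)
    qed
  qed
qed

end

theorem theorem3p1:
  fixes I :: "real set" and f :: "real \<Rightarrow> real" and q :: nat and a :: real
  assumes "open I" and "is_interval I" and "\<not> bdd_above I"
    and "infinitely_differentiable_on f I"
    and "completely_monotone_on ((deriv ^^ q) f) I"
    and "a \<in> I"
  shows "(\<forall>x\<in>I. (\<lambda>k. ((x - a) gchoose k) * (forward_diff ^^ k) f a) sums f x) \<and>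
    (\<forall>K. compact K \<and> K \<subseteq> I \<longrightarrow>
       uniform_limit K (\<lambda>n x. \<Sum>k<n. ((x - a) gchoose k) * (forward_diff ^^ k) f a) f sequentially)"
proof -
  interpret newton_expansion I f q a
    using assms by unfold_locales auto
  have unif: "uniform_limit K (\<lambda>n x. \<Sum>k<n. ((x - a) gchoose k) * (forward_diff ^^ k) f a) f sequentially"
    if "compact K" "K \<subseteq> I" for K
    using uniform_limit_newton_poly[OF \<open>open I\<close> that] by (simp add: poly_newton_poly[abs_def])
  \<comment> \<open>Pointwise convergence is uniform convergence on the compact set
    \<open>{x}\<close>.\<close>
  have "(\<lambda>k. ((x - a) gchoose k) * (forward_diff ^^ k) f a) sums f x" if "x \<in> I" for x
    using tendsto_uniform_limitI[OF unif[of "{x}"], of x] that by (simp add: sums_def)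
  then show ?thesis using unif by blast
qed

end
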